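(* Every circulant digraph is polynomial. That is, if $\Gamma$ is a finite cyclic group and $S\subseteq\Gamma$ is a nonempty generating set not containing the identity, then $\mathrm{Cay}(\Gamma,S)$ is a polynomial digraph.
   Context: Digraphs may be infinite and may have loops and multiple arcs. The (weakly connected) component of a vertex $u$ is the subdigraph induced by all vertices joined to $u$ by a path when arc directions are ignored. For $\Phi(x,y)\in\mathbb{C}[x,y]$, the digraph $G(\Phi)$ has vertex set $\mathbb{C}$, and $(u,v)$ is an arc of multiplicity $m\ge1$ if $v$ is a root of multiplicity $m$ of $\Phi(u,y)$ (if $\Phi(u,y)$ is the zero polynomial, every $(u,v)$ is an arc of multiplicity $1$). Write $\Phi(x,y)=\sum_{i=0}^d a_i(x)y^i=\sum_{j=0}^e b_j(y)x^j$ with $a_d,b_e\neq 0$, and set $A(x)=\gcd(a_0,\dots,a_d)$, $B(y)=\gcd(b_0,\dots,b_e)$, $D(x)=\mathrm{Resultant}(\Phi,\Phi'_y,y)$, $E(y)=\mathrm{Resultant}(\Phi,\Phi'_x,x)$, $L(x)=\Phi(x,x)$, where $\Phi'_x,\Phi'_y$ are the partial derivatives. $\Phi$ is standard if it is non-constant, $A$ and $B$ are constant, and none of $D$, $E$, $L$ is the zero polynomial (non-vanishing of $D$ and $E$ means that $\Phi$ has no repeated non-constant factor). For standard $\Phi$, the singular vertices are the roots of $S(x)=L(x)D(x)E(x)$; equivalently, the vertices $u$ that have a loop, or are the origin or end of a multiple arc, or have $a_d(u)=0$ or $b_e(u)=0$. A singular component is a component containing a singular vertex. A regular digraph (all indegrees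 and outdegrees equal to a common $k$) is called polynomial if, for some standard polynomial $\Phi(x,y)$, it is isomorphic to $G(\Phi)$ or to a non-singular component of $G(\Phi)$. For a group $\Gamma$ and a finite nonempty set $S\subseteq\Gamma$ not containing the identity, $\mathrm{Cay}(\Gamma,S)$ has vertex set $\Gamma$, and $(u,v)$ is an arc (of multiplicity $1$) if and only if $v=su$ for some $s\in S$. A circulant digraph is a strongly connected Cayley digraph on a finite cyclic group (equivalently, $S$ generates the group). *)

theory Defs
  imports
    "HOL-Computational_Algebra.Field_as_Ring"
    "HOL-Computational_Algebra.Polynomial_Factorial"
    "HOL-Algebra.Elementary_Groups"
    "HOL-Algebra.Multiplicative_Group"
    "Subresultants.Resultant_Prelim"
    "Graph_Theory.Graph_Theory"
begin

text \<open>
  A polynomial in \<open>\<complex>[x, y]\<close> is represented as an element of \<open>\<complex>[x][y]\<close>: the outer variable is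
  \<open>y\<close>, and \<open>coeff \<Phi> i\<close> is the polynomial \<open>a\<^sub>i(x)\<close> with \<open>\<Phi> = (\<Sum>i. a\<^sub>i(x) y\<^sup>i)\<close>.
\<close>

type_synonym cpoly2 = "complex poly poly"

text \<open>The same polynomial as an element of \<open>\<complex>[y][x]\<close>, so that \<open>coeff (swap_vars \<Phi>) j\<close> is the
  polynomial \<open>b\<^sub>j(y)\<close> with \<open>\<Phi> = (\<Sum>j. b\<^sub>j(y) x\<^sup>j)\<close>.\<close>

definition swap_vars :: "cpoly2 \<Rightarrow> cpoly2" where
  "swap_vars \<Phi> = (\<Sum>i\<le>Polynomial.degree \<Phi>. map_poly (\<lambda>c. Polynomial.monom c i) (Polynomial.coeff \<Phi> i))"

lemma coeff_swap_vars:
  "Polynomial.coeff (Polynomial.coeff (swap_vars \<Phi>) j) i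
     = Polynomial.coeff (Polynomial.coeff \<Phi> i) j"
proof -
  have "Polynomial.coeff (Polynomial.coeff (swap_vars \<Phi>) j) i =
      (\<Sum>k\<le>Polynomial.degree \<Phi>. if k = i then Polynomial.coeff (Polynomial.coeff \<Phi> k) j else 0)"
    by (simp add: swap_vars_def Polynomial.coeff_sum coeff_map_poly)
  then show ?thesis
    by (cases "i \<le> Polynomial.degree \<Phi>") (auto simp: sum.delta coeff_eq_0)
qed

definition poly_A :: "cpoly2 \<Rightarrow> complex poly" where
  "poly_A \<Phi> = content \<Phi>"

definition poly_B :: "cpoly2 \<Rightarrow> complex poly" where
  "poly_B \<Phi> = content (swap_vars \<Phi>)"

text \<open>\<open>pderiv\<close> differentiates with respect to the outer variable, which is also the one
  eliminated by \<open>resultant\<close>.\<close>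

definition poly_D :: "cpoly2 \<Rightarrow> complex poly" where
  "poly_D \<Phi> = resultant \<Phi> (pderiv \<Phi>)"

definition poly_E :: "cpoly2 \<Rightarrow> complex poly" where
  "poly_E \<Phi> = resultant (swap_vars \<Phi>) (pderiv (swap_vars \<Phi>))"

text \<open>\<open>\<Phi>(x, x)\<close>, the value of \<open>\<Phi> \<in> \<complex>[x][y]\<close> at the polynomial \<open>y = x\<close>.\<close>

definition poly_L :: "cpoly2 \<Rightarrow> complex poly" where
  "poly_L \<Phi> = poly \<Phi> [:0, 1:]"

definition standard_poly :: "cpoly2 \<Rightarrow> bool" where
  "standard_poly \<Phi> \<longleftrightarrow>
     (\<nexists>c. \<Phi> = [:[:c:]:]) \<and>
     Polynomial.degree (poly_A \<Phi>) = 0 \<and> Polynomial.degree (poly_B \<Phi>) = 0 \<and>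
     poly_D \<Phi> \<noteq> 0 \<and> poly_E \<Phi> \<noteq> 0 \<and> poly_L \<Phi> \<noteq> 0"

definition singular_vertex :: "cpoly2 \<Rightarrow> complex \<Rightarrow> bool" where
  "singular_vertex \<Phi> u \<longleftrightarrow> poly (poly_L \<Phi> * poly_D \<Phi> * poly_E \<Phi>) u = 0"

text \<open>The polynomial \<open>\<Phi>(u, y)\<close> in \<open>y\<close>.\<close>

definition poly_at :: "cpoly2 \<Rightarrow> complex \<Rightarrow> complex poly" where
  "poly_at \<Phi> u = map_poly (\<lambda>a. poly a u) \<Phi>"

definition arc_mult :: "cpoly2 \<Rightarrow> complex \<Rightarrow> complex \<Rightarrow> nat" where
  "arc_mult \<Phi> u v = (if poly_at \<Phi> u = 0 then 1 else Polynomial.order v (poly_at \<Phi> u))"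

text \<open>An arc \<open>(u, v)\<close> of multiplicity \<open>m\<close> is represented by the \<open>m\<close> parallel arcs
  \<open>(u, v, 0), \<dots>, (u, v, m - 1)\<close>.\<close>

definition poly_digraph :: "cpoly2 \<Rightarrow> (complex, complex \<times> complex \<times> nat) pre_digraph" where
  "poly_digraph \<Phi> =
     \<lparr> verts = UNIV,
       arcs = {(u, v, i). i < arc_mult \<Phi> u v},
       tail = fst,
       head = fst \<circ> snd \<rparr>"

definition weak_component :: "('a, 'b) pre_digraph \<Rightarrow> 'a \<Rightarrow> ('a, 'b) pre_digraph" where
  "weak_component G u = G \<restriction> {v. u \<rightarrow>\<^sup>*\<^bsub>with_proj (mk_symmetric G)\<^esub> v}"

text \<open>The finiteness conditions are needed because \<open>in_degree\<close> and \<open>out_degree\<close> are cardinalities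
  of sets, which are \<open>0\<close> for infinite sets.\<close>

definition regular_digraph :: "('a, 'b) pre_digraph \<Rightarrow> bool" where
  "regular_digraph G \<longleftrightarrow> wf_digraph G \<and>
     (\<exists>k. \<forall>v\<in>verts G. finite (in_arcs G v) \<and> finite (out_arcs G v) \<and>
            in_degree G v = k \<and> out_degree G v = k)"

definition polynomial_digraph :: "('a, 'b) pre_digraph \<Rightarrow> bool" where
  "polynomial_digraph G \<longleftrightarrow> regular_digraph G \<and>
     (\<exists>\<Phi>. standard_poly \<Phi> \<and>
        (digraph_iso G (poly_digraph \<Phi>) \<or>
         (\<exists>u. (\<forall>v\<in>verts (weak_component (poly_digraph \<Phi>) u). \<not> singular_vertex \<Phi> v) \<and>
              digraph_iso G (weak_component (poly_digraph \<Phi>) u))))"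

definition cayley_digraph :: "'g monoid \<Rightarrow> 'g set \<Rightarrow> ('g, 'g \<times> 'g) pre_digraph" where
  "cayley_digraph \<Gamma> S =
     \<lparr> verts = carrier \<Gamma>,
       arcs = {(u, v). u \<in> carrier \<Gamma> \<and> v \<in> carrier \<Gamma> \<and> (\<exists>s\<in>S. v = s \<otimes>\<^bsub>\<Gamma>\<^esub> u)},
       tail = fst,
       head = snd \<rparr>"

text \<open>For a finite group, the Cayley digraph is strongly connected if and only if the connection
  set generates the group.\<close>

lemma strongly_connected_cayley_digraph_iff:
  assumes "group \<Gamma>" and fin: "finite (carrier \<Gamma>)" and S: "S \<subseteq> carrier \<Gamma>"
  shows "strongly_connected (cayley_digraph \<Gamma> S) \<longleftrightarrow> generate \<Gamma> S = carrier \<Gamma>"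
proof -
  interpret group \<Gamma> by fact
  let ?C = "cayley_digraph \<Gamma> S"
  interpret C: wf_digraph ?C
    by unfold_locales (auto simp: cayley_digraph_def)
  have vC [simp]: "verts ?C = carrier \<Gamma>" by (simp add: cayley_digraph_def)
  have adj: "u \<rightarrow>\<^bsub>?C\<^esub> v \<longleftrightarrow> u \<in> carrier \<Gamma> \<and> v \<in> carrier \<Gamma> \<and> (\<exists>s\<in>S. v = s \<otimes>\<^bsub>\<Gamma>\<^esub> u)" for u v
    by (force simp: cayley_digraph_def arcs_ends_def arc_to_ends_def)
  have gen: "v \<otimes>\<^bsub>\<Gamma>\<^esub> inv\<^bsub>\<Gamma>\<^esub> u \<in> generate \<Gamma> S" if "u \<rightarrow>\<^sup>*\<^bsub>?C\<^esub> v" for u v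
    using that
  proof (induction rule: C.reachable_induct)
    case base
    then show ?case by (auto intro: generate.one)
  next
    case (step x y)
    have u: "u \<in> carrier \<Gamma>" using step(1) C.reachable_in_verts by auto
    obtain s where s: "s \<in> S" "y = s \<otimes>\<^bsub>\<Gamma>\<^esub> x" "x \<in> carrier \<Gamma>" using step(2) adj by auto
    have "y \<otimes>\<^bsub>\<Gamma>\<^esub> inv\<^bsub>\<Gamma>\<^esub> u = s \<otimes>\<^bsub>\<Gamma>\<^esub> (x \<otimes>\<^bsub>\<Gamma>\<^esub> inv\<^bsub>\<Gamma>\<^esub> u)"
      using s u S by (auto simp: m_assoc)
    then show ?case using step.IH s(1) generate.incl generate.eng by metis
  qed
  have step1: "u \<rightarrow>\<^sup>*\<^bsub>?C\<^esub> (s \<otimes>\<^bsub>\<Gamma>\<^esub> u)" if "s \<in> S" "u \<in> carrier \<Gamma>" for s u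
    using that S by (intro C.reachable_adjI) (auto simp: adj)
  have pow: "u \<rightarrow>\<^sup>*\<^bsub>?C\<^esub> (s [^]\<^bsub>\<Gamma>\<^esub> (n::nat) \<otimes>\<^bsub>\<Gamma>\<^esub> u)" if "s \<in> S" "u \<in> carrier \<Gamma>" for s u n
  proof (induction n)
    case 0
    then show ?case using that by (simp add: C.reachable_refl)
  next
    case (Suc n)
    have s: "s \<in> carrier \<Gamma>" using that S by auto
    have "s [^]\<^bsub>\<Gamma>\<^esub> Suc n \<otimes>\<^bsub>\<Gamma>\<^esub> u = s \<otimes>\<^bsub>\<Gamma>\<^esub> (s [^]\<^bsub>\<Gamma>\<^esub> n \<otimes>\<^bsub>\<Gamma>\<^esub> u)"
      using s that(2) by (metis m_assoc nat_pow_Suc2 nat_pow_closed)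
    then show ?case
      using C.reachable_trans[OF Suc] step1[OF that(1), of "s [^]\<^bsub>\<Gamma>\<^esub> n \<otimes>\<^bsub>\<Gamma>\<^esub> u"] s that(2) by auto
  qed
  have reach: "u \<rightarrow>\<^sup>*\<^bsub>?C\<^esub> (g \<otimes>\<^bsub>\<Gamma>\<^esub> u)" if "g \<in> generate \<Gamma> S" "u \<in> carrier \<Gamma>" for g u
    using that
  proof (induction arbitrary: u rule: generate.induct)
    case one
    then show ?case by (simp add: C.reachable_refl)
  next
    case (incl h)
    then show ?case by (rule step1)
  next
    case (inv h)
    have h: "h \<in> carrier \<Gamma>" using inv S by auto
    have "Coset.order \<Gamma> > 0" using fin order_gt_0_iff_finite by blast
    then obtain n where "Coset.order \<Gamma> = Suc n" using gr0_implies_Suc by blast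
    then have "h [^]\<^bsub>\<Gamma>\<^esub> n \<otimes>\<^bsub>\<Gamma>\<^esub> h = \<one>\<^bsub>\<Gamma>\<^esub>" using pow_order_eq_1[OF h] by simp
    then have "h [^]\<^bsub>\<Gamma>\<^esub> n = inv\<^bsub>\<Gamma>\<^esub> h" using h by (metis inv_equality nat_pow_closed)
    then show ?case using pow[OF inv(1,2), of n] by simp
  next
    case (eng h1 h2)
    have h: "h1 \<in> carrier \<Gamma>" "h2 \<in> carrier \<Gamma>"
      using eng.hyps generate_in_carrier[OF S] by auto
    show ?case
      using C.reachable_trans[OF eng.IH(2)[OF eng.prems] eng.IH(1)[of "h2 \<otimes>\<^bsub>\<Gamma>\<^esub> u"]] h eng.prems
      by (simp add: m_assoc)
  qed
  show ?thesis
  proof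
    assume sc: "strongly_connected ?C"
    have "g \<in> generate \<Gamma> S" if "g \<in> carrier \<Gamma>" for g
      using gen[of "\<one>\<^bsub>\<Gamma>\<^esub>" g] sc that by (auto simp: strongly_connected_def)
    then show "generate \<Gamma> S = carrier \<Gamma>" using generate_in_carrier[OF S] by blast
  next
    assume g: "generate \<Gamma> S = carrier \<Gamma>"
    show "strongly_connected ?C"
      unfolding strongly_connected_def
    proof (intro conjI ballI)
      show "verts ?C \<noteq> {}" by auto
      fix u v assume "u \<in> verts ?C" "v \<in> verts ?C"
      then have uv: "u \<in> carrier \<Gamma>" "v \<in> carrier \<Gamma>" by simp_all
      then show "u \<rightarrow>\<^sup>*\<^bsub>?C\<^esub> v"
        using reach[of "v \<otimes>\<^bsub>\<Gamma>\<^esub> inv\<^bsub>\<Gamma>\<^esub> u" u] g by (simp add: m_assoc)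
    qed
  qed
qed

end

theory Submission
  imports Defs "Subresultants.Subresultant_Gcd"
    "HOL-Computational_Algebra.Fundamental_Theorem_Algebra"
begin

text \<open>
  A finite cyclic group \<open>\<Gamma>\<close> has a faithful character: sending a generator to a primitive root of
  unity of order \<open>|\<Gamma>|\<close> defines an injective homomorphism \<open>\<chi> : \<Gamma> \<rightarrow> \<complex>\<^sup>\<times>\<close>. Through it the arcs
  \<open>x \<rightarrow> s x\<close> of the Cayley digraph become the arcs \<open>u \<rightarrow> \<chi>(s) u\<close>, and these are cut out by
  \<open>\<Phi>(x, y) = (\<Prod>s\<in>S. y - \<chi>(s) x)\<close>.

  A product of linear forms through the origin is easy to control. For \<open>u \<noteq> 0\<close> the roots
  \<open>\<chi>(s) u\<close> of \<open>\<Phi>(u, y)\<close> are distinct, and so are the roots \<open>u / \<chi>(s)\<close> of \<open>\<Phi>(x, u)\<close>, so neither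
  discriminant vanishes at \<open>u\<close> (\<open>poly_discriminant_linear_forms\<close>); since
  \<open>1 \<notin> S\<close>, there is no loop at \<open>u\<close>. Thus \<open>0\<close> is the only vertex that can be singular
  (\<open>singular_vertex_imp_0\<close>), and as \<open>\<Phi>\<close> has constant leading coefficients in both variables, it is
  standard. The component of \<open>1\<close> consists of what is reached from \<open>1\<close> by multiplying
  with the \<open>\<chi>(s)\<close> and their inverses (\<open>component_of_1\<close>). As \<open>S\<close> generates \<open>\<Gamma>\<close>, this is
  \<open>\<chi>(\<Gamma>)\<close>; it avoids \<open>0\<close>, and \<open>\<chi>\<close> is an isomorphism from the Cayley digraph onto
  this component.
\<close>

section \<open>Exchanging the variables\<close>

lemma swap_vars_mult: "swap_vars (p * q) = swap_vars p * swap_vars q"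
proof (intro poly_eqI)
  fix i j
  have "coeff (coeff (swap_vars (p * q)) j) i
      = (\<Sum>k\<le>i. \<Sum>l\<le>j. coeff (coeff p k) l * coeff (coeff q (i - k)) (j - l))"
    by (simp add: coeff_swap_vars coeff_mult coeff_sum)
  also have "\<dots> = coeff (coeff (swap_vars p * swap_vars q) j) i"
    unfolding coeff_mult coeff_sum coeff_swap_vars by (rule sum.swap)
  finally show "coeff (coeff (swap_vars (p * q)) j) i
      = coeff (coeff (swap_vars p * swap_vars q) j) i" .
qed

lemma swap_vars_1: "swap_vars 1 = 1"
  by (intro poly_eqI) (simp add: coeff_swap_vars coeff_1)

lemma swap_vars_prod: "swap_vars (\<Prod>s\<in>S. f s) = (\<Prod>s\<in>S. swap_vars (f s))"
  by (induction S rule: infinite_finite_induct) (simp_all add: swap_vars_1 swap_vars_mult)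

section \<open>Products of linear forms\<close>

text \<open>The product of the forms \<open>a(s) x + b(s) y\<close>. Keeping both coefficients free makes this class
  closed under exchanging the variables, so that statements about one variable also serve for
  the other.\<close>

definition linear_forms :: "('s \<Rightarrow> complex) \<Rightarrow> ('s \<Rightarrow> complex) \<Rightarrow> 's set \<Rightarrow> cpoly2" where
  "linear_forms a b S = (\<Prod>s\<in>S. [:[:0, a s:], [:b s:]:])"

lemma swap_vars_linear_forms: "swap_vars (linear_forms a b S) = linear_forms b a S"
proof -
  have "swap_vars [:[:0, \<alpha>:], [:\<beta>:]:] = [:[:0, \<beta>:], [:\<alpha>:]:]" for \<alpha> \<beta>
    by (intro poly_eqI) (simp add: coeff_swap_vars coeff_pCons split: nat.splits)
  then show ?thesis by (simp add: linear_forms_def swap_vars_prod)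
qed

lemma lead_coeff_linear_forms:
  assumes "\<And>s. s \<in> S \<Longrightarrow> b s \<noteq> 0"
  shows "lead_coeff (linear_forms a b S) = [:\<Prod>s\<in>S. b s:]"
proof -
  have "lead_coeff (linear_forms a b S) = (\<Prod>s\<in>S. [:b s:])"
    unfolding linear_forms_def lead_coeff_prod using assms by (intro prod.cong) auto
  also have "\<dots> = [:\<Prod>s\<in>S. b s:]"
    by (induction S rule: infinite_finite_induct) (simp_all add: pCons_one)
  finally show ?thesis .
qed

lemma degree_linear_forms:
  assumes "\<And>s. s \<in> S \<Longrightarrow> b s \<noteq> 0"
  shows "Polynomial.degree (linear_forms a b S) = card S"
  unfolding linear_forms_def using assms
  by (subst degree_prod_eq_sum_degree) auto

text \<open>The content divides every coefficient, in particular a constant leading one.\<close>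

lemma degree_content_eq_0:
  fixes \<Phi> :: cpoly2
  assumes "lead_coeff \<Phi> = [:c:]" "c \<noteq> 0"
  shows "Polynomial.degree (content \<Phi>) = 0"
proof -
  have "content \<Phi> dvd [:c:]"
    using content_dvd_coeff[of \<Phi> "Polynomial.degree \<Phi>"] assms(1) by simp
  with assms(2) show ?thesis
    using divides_degree[of "content \<Phi>" "[:c:]"] by simp
qed

lemma poly_at_linear_forms:
  "poly_at (linear_forms a b S) u = (\<Prod>s\<in>S. [:a s * u, b s:])"
proof -
  have "poly_at (p * q) u = poly_at p u * poly_at q u" for p q
    unfolding poly_at_def by (intro poly_eqI) (simp add: coeff_map_poly coeff_mult poly_sum)
  moreover have "poly_at 1 u = 1"
    unfolding poly_at_def by simp
  moreover have "poly_at [:[:0, \<alpha>:], [:\<beta>:]:] u = [:\<alpha> * u, \<beta>:]" for \<alpha> \<beta>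
    unfolding poly_at_def
    by (intro poly_eqI) (simp add: coeff_map_poly coeff_pCons split: nat.splits)
  ultimately show ?thesis
    unfolding linear_forms_def
    by (induction S rule: infinite_finite_induct)
      (simp_all del: mult_pCons_left mult_pCons_right)
qed

lemma order_linear_factor:
  fixes \<alpha> \<beta> v :: complex
  assumes "\<beta> \<noteq> 0"
  shows "Polynomial.order v [:\<alpha>, \<beta>:] = (if \<alpha> + \<beta> * v = 0 then 1 else 0)"
proof (cases "\<alpha> + \<beta> * v = 0")
  case True
  have "Polynomial.order v [:\<alpha>, \<beta>:] \<le> Polynomial.degree [:\<alpha>, \<beta>:]"
    using assms by (intro order_degree) auto
  moreover have "Polynomial.order v [:\<alpha>, \<beta>:] \<noteq> 0"
    using True assms order_root[of "[:\<alpha>, \<beta>:]" v] by (simp add: mult.commute)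
  ultimately show ?thesis using True assms by simp
next
  case False
  then show ?thesis by (simp add: order_0I mult.commute)
qed

lemma order_prod_linear:
  fixes \<alpha> \<beta> :: "'s \<Rightarrow> complex"
  assumes "finite S" "\<And>s. s \<in> S \<Longrightarrow> \<beta> s \<noteq> 0"
  shows "Polynomial.order v (\<Prod>s\<in>S. [:\<alpha> s, \<beta> s:]) = card {s \<in> S. \<alpha> s + \<beta> s * v = 0}"
proof -
  have "Polynomial.order v (\<Prod>s\<in>S. [:\<alpha> s, \<beta> s:]) = (\<Sum>s\<in>S. Polynomial.order v [:\<alpha> s, \<beta> s:])"
    using assms
  proof (induction S rule: finite_induct)
    case (insert x F)
    then have "[:\<alpha> x, \<beta> x:] * (\<Prod>s\<in>F. [:\<alpha> s, \<beta> s:]) \<noteq> 0"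
      by (simp del: mult_pCons_left)
    with insert show ?case
      by (simp add: order_mult del: mult_pCons_left mult_pCons_right)
  qed simp
  also have "\<dots> = (\<Sum>s\<in>S. if \<alpha> s + \<beta> s * v = 0 then 1 else 0)"
    using assms by (intro sum.cong) (simp_all add: order_linear_factor)
  also have "\<dots> = card {s \<in> S. \<alpha> s + \<beta> s * v = 0}"
    using assms(1) by (simp add: sum.If_cases Int_def)
  finally show ?thesis .
qed

section \<open>Non-vanishing discriminants\<close>

text \<open>When the leading coefficient is constant, specialising \<open>x\<close> to \<open>u\<close> keeps the degrees of \<open>\<Phi>\<close> and
  of its derivative, and hence commutes with the resultant. What remains is the resultant of a
  complex polynomial and its derivative, which vanishes only at a common root.\<close>

lemma poly_discriminant_nonzero:
  fixes \<Phi> :: cpoly2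
  assumes lead: "lead_coeff \<Phi> = [:c:]" "c \<noteq> 0" and sf: "rsquarefree (poly_at \<Phi> u)"
  shows "poly (resultant \<Phi> (pderiv \<Phi>)) u \<noteq> 0"
proof -
  have ev: "comm_ring_hom (\<lambda>p. poly p u)"
    by unfold_locales auto
  have pd: "poly_at (pderiv \<Phi>) u = pderiv (poly_at \<Phi> u)"
    by (intro poly_eqI) (simp add: poly_at_def coeff_map_poly coeff_pderiv)
  have "coeff (poly_at \<Phi> u) (Polynomial.degree \<Phi>) \<noteq> 0"
    using lead by (simp add: poly_at_def coeff_map_poly)
  then have deg: "Polynomial.degree (poly_at \<Phi> u) = Polynomial.degree \<Phi>"
    using le_degree degree_map_poly_le unfolding poly_at_def by (metis le_antisym)
  have deg': "Polynomial.degree (poly_at (pderiv \<Phi>) u) = Polynomial.degree (pderiv \<Phi>)"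
    unfolding pd using deg by (simp add: degree_pderiv)
  have "poly (resultant \<Phi> (pderiv \<Phi>)) u = resultant (poly_at \<Phi> u) (pderiv (poly_at \<Phi> u))"
    unfolding pd[symmetric] using deg deg' comm_ring_hom.resultant_map_poly[OF ev, of \<Phi> "pderiv \<Phi>"]
    unfolding poly_at_def by simp
  moreover have "Polynomial.degree (gcd (poly_at \<Phi> u) (pderiv (poly_at \<Phi> u))) = 0"
  proof (rule ccontr)
    assume "Polynomial.degree (gcd (poly_at \<Phi> u) (pderiv (poly_at \<Phi> u))) \<noteq> 0"
    then obtain z where "poly (gcd (poly_at \<Phi> u) (pderiv (poly_at \<Phi> u))) z = 0"
      by (metis fundamental_theorem_of_algebra constant_degree)
    then have "poly (poly_at \<Phi> u) z = 0" "poly (pderiv (poly_at \<Phi> u)) z = 0"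
      by (meson gcd_dvd1 gcd_dvd2 dvd_trans poly_eq_0_iff_dvd)+
    with sf show False by (auto simp: rsquarefree_roots)
  qed
  ultimately show ?thesis by (simp add: resultant_0_gcd)
qed

text \<open>At \<open>u \<noteq> 0\<close> the factor belonging to \<open>s\<close> has the root \<open>- u a(s) / b(s)\<close>, and these roots differ
  as soon as the slopes \<open>a(s) / b(s)\<close> do.\<close>

lemma poly_discriminant_linear_forms:
  assumes fin: "finite S" and b: "\<And>s. s \<in> S \<Longrightarrow> b s \<noteq> 0"
    and inj: "inj_on (\<lambda>s. a s / b s) S" and u: "u \<noteq> 0"
  shows "poly (resultant (linear_forms a b S) (pderiv (linear_forms a b S))) u \<noteq> 0"
proof (rule poly_discriminant_nonzero)
  show "lead_coeff (linear_forms a b S) = [:\<Prod>s\<in>S. b s:]" "(\<Prod>s\<in>S. b s) \<noteq> 0"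
    using lead_coeff_linear_forms[of S b a] fin b by auto
  have "(\<Prod>s\<in>S. [:a s * u, b s:]) \<noteq> 0" using fin b by auto
  moreover have "card {s \<in> S. a s * u + b s * v = 0} \<le> 1" for v
  proof -
    have "a s / b s = - (v / u)" if "s \<in> S" "a s * u + b s * v = 0" for s
      using that b[of s] u by (auto simp: field_simps add_eq_0_iff)
    then have "s = t" if "s \<in> {s \<in> S. a s * u + b s * v = 0}"
      "t \<in> {s \<in> S. a s * u + b s * v = 0}" for s t
      using that inj by (auto simp: inj_on_def)
    then show ?thesis using fin by (auto simp: card_le_Suc0_iff_eq)
  qed
  ultimately show "rsquarefree (poly_at (linear_forms a b S) u)"
    using fin b unfolding poly_at_linear_forms rsquarefree_def
    by (auto simp: order_prod_linear le_Suc_eq)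
qed

section \<open>A faithful character of a finite cyclic group\<close>

text \<open>A generator \<open>g\<close> and a primitive root of unity \<open>\<omega>\<close> of order \<open>ord g\<close> satisfy the same equalities
  between powers, so \<open>g\<^sup>k \<mapsto> \<omega>\<^sup>k\<close> is well defined and injective.\<close>

lemma finite_cyclic_group_faithful_character:
  assumes "group \<Gamma>" "finite (carrier \<Gamma>)" "cyclic_group \<Gamma>"
  obtains \<chi> :: "'g \<Rightarrow> complex" where
    "inj_on \<chi> (carrier \<Gamma>)" "\<And>x. \<chi> x \<noteq> 0"
    "\<And>x y. x \<in> carrier \<Gamma> \<Longrightarrow> y \<in> carrier \<Gamma> \<Longrightarrow> \<chi> (x \<otimes>\<^bsub>\<Gamma>\<^esub> y) = \<chi> x * \<chi> y"
proof -
  interpret group \<Gamma> by fact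
  obtain g where g: "g \<in> carrier \<Gamma>" and gen: "carrier \<Gamma> = range (\<lambda>k::int. g [^]\<^bsub>\<Gamma>\<^esub> k)"
    using assms(3) cyclic_group by auto
  define n where "n = ord g"
  have n: "n > 0" using ord_ge_1[OF assms(2) g] by (simp add: n_def)
  define \<omega> where "\<omega> = cis (2 * pi / n)"
  have \<omega>0: "\<omega> \<noteq> 0" by (simp add: \<omega>_def)
  have \<omega>n: "\<omega> ^ n = 1" using n by (simp add: \<omega>_def DeMoivre)
  have pow_inj: "inj_on (\<lambda>k. \<omega> ^ k) {..<n}"
    using bij_betw_roots_unity[OF n] by (simp add: bij_betw_def \<omega>_def DeMoivre mult_ac)
  have \<omega>1: "\<omega> powi k = 1 \<longleftrightarrow> int n dvd k" for k
  proof -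
    define r where "r = nat (k mod int n)"
    have r: "r < n" "int r = k mod int n" using n by (auto simp: r_def nat_less_iff)
    have "\<omega> powi k = \<omega> powi (int n * (k div int n) + int r)"
      unfolding r by simp
    also have "\<dots> = (\<omega> powi int n) powi (k div int n) * \<omega> powi int r"
      using \<omega>0 by (simp only: power_int_add power_int_mult simp_thms)
    also have "\<dots> = \<omega> ^ r" using \<omega>n by simp
    finally have "\<omega> powi k = \<omega> ^ r" .
    moreover have "\<omega> ^ r = 1 \<longleftrightarrow> r = 0"
      using inj_onD[OF pow_inj, of r 0] r n by auto
    ultimately show ?thesis using r by (metis dvd_eq_mod_eq_0 of_nat_0 of_nat_eq_iff)
  qed
  have \<omega>_eq: "\<omega> powi j = \<omega> powi k \<longleftrightarrow> g [^]\<^bsub>\<Gamma>\<^esub> j = g [^]\<^bsub>\<Gamma>\<^esub> k" for j k :: int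
  proof -
    have "\<omega> powi j = \<omega> powi k \<longleftrightarrow> \<omega> powi (k - j) = 1"
      using \<omega>0 by (auto simp: power_int_diff)
    then show ?thesis by (simp add: \<omega>1 int_pow_eq[OF g] n_def)
  qed
  \<comment> \<open>An exponent of \<open>x\<close> is determined only modulo \<open>n\<close>; any choice gives the same power of \<open>\<omega>\<close>.\<close>
  define e where "e x = (SOME k::int. x = g [^]\<^bsub>\<Gamma>\<^esub> k)" for x
  have e: "g [^]\<^bsub>\<Gamma>\<^esub> e x = x" if "x \<in> carrier \<Gamma>" for x
    unfolding e_def by (rule someI2_ex) (use that gen in auto)
  show ?thesis
  proof (rule that[of "\<lambda>x. \<omega> powi e x"])
    show "inj_on (\<lambda>x. \<omega> powi e x) (carrier \<Gamma>)"
      by (rule inj_onI) (metis \<omega>_eq e)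
    show "\<omega> powi e x \<noteq> 0" for x using \<omega>0 by simp
    fix x y assume xy: "x \<in> carrier \<Gamma>" "y \<in> carrier \<Gamma>"
    have "g [^]\<^bsub>\<Gamma>\<^esub> (e x + e y) = g [^]\<^bsub>\<Gamma>\<^esub> e (x \<otimes>\<^bsub>\<Gamma>\<^esub> y)"
      using xy g by (simp add: e int_pow_mult)
    then show "\<omega> powi e (x \<otimes>\<^bsub>\<Gamma>\<^esub> y) = \<omega> powi e x * \<omega> powi e y"
      using \<omega>0 by (metis \<omega>_eq power_int_add)
  qed
qed

section \<open>The Cayley digraph inside the digraph of a polynomial\<close>

lemma regular_cayley_digraph:
  assumes "group \<Gamma>" "finite S" "S \<subseteq> carrier \<Gamma>"
  shows "regular_digraph (cayley_digraph \<Gamma> S)"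
proof -
  interpret group \<Gamma> by fact
  let ?C = "cayley_digraph \<Gamma> S"
  have "out_arcs ?C v = (\<lambda>s. (v, s \<otimes>\<^bsub>\<Gamma>\<^esub> v)) ` S"
    and "in_arcs ?C v = (\<lambda>s. (inv\<^bsub>\<Gamma>\<^esub> s \<otimes>\<^bsub>\<Gamma>\<^esub> v, v)) ` S" if v: "v \<in> carrier \<Gamma>" for v
  proof -
    show "out_arcs ?C v = (\<lambda>s. (v, s \<otimes>\<^bsub>\<Gamma>\<^esub> v)) ` S"
      using v assms(3) by (auto simp: out_arcs_def cayley_digraph_def)
    have "v = s \<otimes>\<^bsub>\<Gamma>\<^esub> u \<longleftrightarrow> u = inv\<^bsub>\<Gamma>\<^esub> s \<otimes>\<^bsub>\<Gamma>\<^esub> v" if "s \<in> S" "u \<in> carrier \<Gamma>" for s u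
      using that v assms(3) by (auto simp: subset_eq inv_solve_left m_assoc[symmetric])
    then show "in_arcs ?C v = (\<lambda>s. (inv\<^bsub>\<Gamma>\<^esub> s \<otimes>\<^bsub>\<Gamma>\<^esub> v, v)) ` S"
      using v assms(3) by (fastforce simp: in_arcs_def cayley_digraph_def)
  qed
  moreover have "inj_on (\<lambda>s. (v, s \<otimes>\<^bsub>\<Gamma>\<^esub> v)) S" "inj_on (\<lambda>s. (inv\<^bsub>\<Gamma>\<^esub> s \<otimes>\<^bsub>\<Gamma>\<^esub> v, v)) S"
    if "v \<in> carrier \<Gamma>" for v
    using that assms(3) by (auto simp: inj_on_def subset_eq)
  moreover have "wf_digraph ?C"
    by unfold_locales (auto simp: cayley_digraph_def)
  moreover have "verts ?C = carrier \<Gamma>" by (simp add: cayley_digraph_def)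
  ultimately show ?thesis
    unfolding regular_digraph_def using assms(2)
    by (auto simp: in_degree_def out_degree_def card_image)
qed

locale faithful_character = group \<Gamma> for \<Gamma> :: "'g monoid" (structure) +
  fixes \<chi> :: "'g \<Rightarrow> complex" and S :: "'g set"
  assumes inj: "inj_on \<chi> (carrier \<Gamma>)" and nonzero: "\<And>x. \<chi> x \<noteq> 0"
    and mult: "\<And>x y. x \<in> carrier \<Gamma> \<Longrightarrow> y \<in> carrier \<Gamma> \<Longrightarrow> \<chi> (x \<otimes> y) = \<chi> x * \<chi> y"
    and S: "S \<subseteq> carrier \<Gamma>" "S \<noteq> {}" "\<one> \<notin> S" and fin: "finite S"
begin

definition cayley_poly :: cpoly2 where "cayley_poly = linear_forms (\<lambda>s. - \<chi> s) (\<lambda>_. 1) S"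

lemma \<chi>_one: "\<chi> \<one> = 1"
  using mult[of \<one> \<one>] nonzero[of \<one>] by simp

lemma \<chi>_inj_S: "inj_on \<chi> S"
  using inj S(1) inj_on_subset by blast

text \<open>The polynomial \<open>\<Phi>(x, x)\<close> is the product of the factors \<open>(1 - \<chi>(s)) x\<close>, and \<open>\<chi>(s) = 1\<close> only for
  the identity.\<close>

lemma poly_L_nonzero: assumes "u \<noteq> 0" shows "poly (poly_L cayley_poly) u \<noteq> 0"
proof -
  have "\<chi> s \<noteq> 1" if "s \<in> S" for s
    using that inj_onD[OF inj, of s \<one>] S \<chi>_one by auto
  then show ?thesis
    using assms fin by (simp add: poly_L_def cayley_poly_def linear_forms_def poly_prod prod_zero_iff)
qed

lemma poly_D_nonzero: assumes "u \<noteq> 0" shows "poly (poly_D cayley_poly) u \<noteq> 0"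
  unfolding poly_D_def cayley_poly_def
  using assms fin \<chi>_inj_S by (intro poly_discriminant_linear_forms) (auto simp: inj_on_def)

lemma poly_E_nonzero: assumes "u \<noteq> 0" shows "poly (poly_E cayley_poly) u \<noteq> 0"
  unfolding poly_E_def cayley_poly_def swap_vars_linear_forms
  using assms fin \<chi>_inj_S nonzero by (intro poly_discriminant_linear_forms) (auto simp: inj_on_def)

lemma singular_vertex_imp_0: "singular_vertex cayley_poly u \<Longrightarrow> u = 0"
  using poly_L_nonzero poly_D_nonzero poly_E_nonzero by (auto simp: singular_vertex_def)

lemma standard_cayley_poly: "standard_poly cayley_poly"
  unfolding standard_poly_def
proof (intro conjI)
  have "Polynomial.degree cayley_poly \<noteq> 0"
    using S fin by (simp add: cayley_poly_def degree_linear_forms)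
  then show "\<nexists>c. cayley_poly = [:[:c:]:]" by auto
  show "Polynomial.degree (poly_A cayley_poly) = 0"
    unfolding poly_A_def cayley_poly_def
    by (rule degree_content_eq_0[OF lead_coeff_linear_forms]) auto
  show "Polynomial.degree (poly_B cayley_poly) = 0"
    unfolding poly_B_def cayley_poly_def swap_vars_linear_forms
    by (rule degree_content_eq_0[OF lead_coeff_linear_forms]) (use nonzero fin in auto)
  show "poly_D cayley_poly \<noteq> 0" "poly_E cayley_poly \<noteq> 0" "poly_L cayley_poly \<noteq> 0"
    using poly_D_nonzero[of 1] poly_E_nonzero[of 1] poly_L_nonzero[of 1] by auto
qed

lemma arc_mult_cayley_poly: "arc_mult cayley_poly u v = card {s \<in> S. v = \<chi> s * u}"
proof -
  have "(\<Prod>s\<in>S. [:- \<chi> s * u, 1:]) \<noteq> 0" using fin by auto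
  then have "arc_mult cayley_poly u v = card {s \<in> S. - \<chi> s * u + 1 * v = 0}"
    unfolding arc_mult_def cayley_poly_def poly_at_linear_forms
    using order_prod_linear[OF fin, of "\<lambda>_. 1" v "\<lambda>s. - \<chi> s * u"] by simp
  also have "{s \<in> S. - \<chi> s * u + 1 * v = 0} = {s \<in> S. v = \<chi> s * u}" by auto
  finally show ?thesis .
qed

text \<open>Away from the origin the digraph has no multiple arcs, because \<open>\<chi>\<close> is injective. (The
  origin carries a loop of multiplicity \<open>|S|\<close>.)\<close>

lemma arc_index_iff:
  assumes "u \<noteq> 0"
  shows "i < arc_mult cayley_poly u v \<longleftrightarrow> i = 0 \<and> (\<exists>s\<in>S. v = \<chi> s * u)"
proof (cases "\<exists>s\<in>S. v = \<chi> s * u")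
  case True
  then obtain s where s: "s \<in> S" "v = \<chi> s * u" by auto
  have "{t \<in> S. v = \<chi> t * u} = {s}"
    using s assms inj_onD[OF \<chi>_inj_S] by auto
  then show ?thesis using True by (simp add: arc_mult_cayley_poly)
next
  case False
  then have "{s \<in> S. v = \<chi> s * u} = {}" by auto
  then have "arc_mult cayley_poly u v = 0" unfolding arc_mult_cayley_poly by (metis card.empty)
  with False show ?thesis by simp
qed

text \<open>This describes adjacency at all vertices, the origin included, since only the existence of
  an arc matters here.\<close>

lemma adjacent_iff:
  "(u, v) \<in> parcs (mk_symmetric (poly_digraph cayley_poly)) \<longleftrightarrow> (\<exists>s\<in>S. v = \<chi> s * u \<or> u = \<chi> s * v)"
proof -
  have *: "(\<exists>i. i < arc_mult cayley_poly u v) \<longleftrightarrow> (\<exists>s\<in>S. v = \<chi> s * u)" for u v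
  proof -
    have "(\<exists>i. i < arc_mult cayley_poly u v) \<longleftrightarrow> card {s \<in> S. v = \<chi> s * u} \<noteq> 0"
      unfolding arc_mult_cayley_poly by auto
    then show ?thesis using fin by auto
  qed
  have "(u, v) \<in> parcs (mk_symmetric (poly_digraph cayley_poly))
      \<longleftrightarrow> (\<exists>i. i < arc_mult cayley_poly u v) \<or> (\<exists>i. i < arc_mult cayley_poly v u)"
    by (force simp: parcs_mk_symmetric poly_digraph_def)
  then show ?thesis unfolding * by blast
qed

text \<open>The set \<open>\<chi>(\<Gamma>)\<close> is closed under adjacency, as \<open>\<Gamma>\<close> is closed under left multiplication by
  \<open>s\<close> and by its inverse. Conversely, writing an element \<open>g\<close> as a word in the generators and their
  inverses yields an undirected path from \<open>\<chi>(h)\<close> to \<open>\<chi>(g h)\<close>. The starting point \<open>h\<close> has to be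
  arbitrary in the induction, because the paths for two factors are concatenated.\<close>

lemma component_of_1:
  assumes gen: "generate \<Gamma> S = carrier \<Gamma>"
  shows "{v. 1 \<rightarrow>\<^sup>*\<^bsub>with_proj (mk_symmetric (poly_digraph cayley_poly))\<^esub> v} = \<chi> ` carrier \<Gamma>"
proof -
  let ?R = "parcs (mk_symmetric (poly_digraph cayley_poly))"
  have reach: "1 \<rightarrow>\<^sup>*\<^bsub>with_proj (mk_symmetric (poly_digraph cayley_poly))\<^esub> v \<longleftrightarrow> (1, v) \<in> ?R\<^sup>*" for v
  proof -
    have V: "verts (poly_digraph cayley_poly) = UNIV" by (simp add: poly_digraph_def)
    show ?thesis
      unfolding reachable_def with_proj_simps pverts_mk_symmetric V
      by (auto intro: rtrancl_on_rtranclI rtrancl_consistent_rtrancl_on)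
  qed
  have "v \<in> \<chi> ` carrier \<Gamma>" if "(1, v) \<in> ?R\<^sup>*" for v
    using that
  proof (induction rule: rtrancl_induct)
    case base
    show ?case using \<chi>_one one_closed by (metis imageI)
  next
    case (step v w)
    then obtain g where g: "g \<in> carrier \<Gamma>" "v = \<chi> g" by auto
    from step(2) obtain s where s: "s \<in> S" "w = \<chi> s * v \<or> v = \<chi> s * w"
      unfolding adjacent_iff by auto
    have sc: "s \<in> carrier \<Gamma>" using s S by auto
    have "w = \<chi> (s \<otimes> g)" if "w = \<chi> s * v"
      using that g sc by (simp add: mult)
    moreover have "w = \<chi> (inv s \<otimes> g)" if "v = \<chi> s * w"
    proof -
      have "\<chi> s * \<chi> (inv s \<otimes> g) = \<chi> s * w"
        using that g sc mult[of s "inv s \<otimes> g"] by (auto simp: m_assoc[symmetric])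
      then show ?thesis using nonzero[of s] by auto
    qed
    ultimately show ?case using s(2) sc g(1) by blast
  qed
  moreover have "(\<chi> h, \<chi> (g \<otimes> h)) \<in> ?R\<^sup>*" if "g \<in> generate \<Gamma> S" "h \<in> carrier \<Gamma>" for g h
    using that
  proof (induction arbitrary: h rule: generate.induct)
    case one
    then show ?case by simp
  next
    case (incl s)
    then have "\<chi> (s \<otimes> h) = \<chi> s * \<chi> h" using S(1) by (auto simp: mult)
    then show ?case using incl(1) by (intro r_into_rtrancl) (auto simp: adjacent_iff)
  next
    case (inv s)
    have "s \<otimes> (inv s \<otimes> h) = h" using inv S(1) by (simp add: m_assoc[symmetric] subset_eq)
    then have "\<chi> h = \<chi> s * \<chi> (inv s \<otimes> h)"
      using inv S(1) mult[of s "inv s \<otimes> h"] by auto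
    then show ?case using inv(1) by (intro r_into_rtrancl) (auto simp: adjacent_iff)
  next
    case (eng g g')
    have g: "g \<in> carrier \<Gamma>" "g' \<in> carrier \<Gamma>" using eng.hyps gen by auto
    have "(\<chi> h, \<chi> (g \<otimes> (g' \<otimes> h))) \<in> ?R\<^sup>*"
      using eng.IH(2)[of h] eng.IH(1)[of "g' \<otimes> h"] eng.prems g by auto
    then show ?case using g eng.prems by (simp add: m_assoc)
  qed
  then have "(1, \<chi> g) \<in> ?R\<^sup>*" if "g \<in> carrier \<Gamma>" for g
    using that gen \<chi>_one by (metis one_closed r_one)
  ultimately show ?thesis unfolding reach by auto
qed

text \<open>The map \<open>\<chi>\<close> on vertices extends to arcs by giving every arc the index \<open>0\<close>, the only index
  that occurs on \<open>\<chi>(\<Gamma>)\<close>.\<close>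

lemma cayley_digraph_iso_component:
  assumes gen: "generate \<Gamma> S = carrier \<Gamma>"
  shows "digraph_iso (cayley_digraph \<Gamma> S) (weak_component (poly_digraph cayley_poly) 1)"
proof -
  let ?C = "cayley_digraph \<Gamma> S"
  let ?h = "\<lparr> iso_verts = \<chi>, iso_arcs = (\<lambda>(x, y). (\<chi> x, \<chi> y, 0)),
    iso_head = fst \<circ> snd, iso_tail = fst \<rparr> :: ('g, 'g \<times> 'g, complex, complex \<times> complex \<times> nat) digraph_isomorphism"
  have "pre_digraph.digraph_isomorphism ?C ?h"
  proof -
    have "wf_digraph ?C"
      by unfold_locales (auto simp: cayley_digraph_def)
    then show ?thesis
      using inj by (auto simp: pre_digraph.digraph_isomorphism_def cayley_digraph_def inj_on_def)
  qed
  moreover have "weak_component (poly_digraph cayley_poly) 1 = app_iso ?h ?C"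
  proof -
    have "{e \<in> arcs (poly_digraph cayley_poly). fst e \<in> \<chi> ` carrier \<Gamma> \<and> fst (snd e) \<in> \<chi> ` carrier \<Gamma>}
        = (\<lambda>(x, y). (\<chi> x, \<chi> y, 0)) ` arcs ?C" (is "?L = ?R")
    proof (rule Set.set_eqI)
      fix e :: "complex \<times> complex \<times> nat"
      obtain u v i where e: "e = (u, v, i)" by (cases e)
      have eq: "\<chi> y = \<chi> s * \<chi> x \<longleftrightarrow> y = s \<otimes> x"
        if "x \<in> carrier \<Gamma>" "y \<in> carrier \<Gamma>" "s \<in> S" for x y s
        using that S(1) inj_onD[OF inj, of y "s \<otimes> x"] by (auto simp: mult[symmetric])
      have "e \<in> ?L \<longleftrightarrow> (\<exists>x\<in>carrier \<Gamma>. \<exists>y\<in>carrier \<Gamma>. u = \<chi> x \<and> v = \<chi> y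
          \<and> i < arc_mult cayley_poly (\<chi> x) (\<chi> y))"
        unfolding e by (auto simp: poly_digraph_def)
      also have "\<dots> \<longleftrightarrow> (\<exists>x\<in>carrier \<Gamma>. \<exists>y\<in>carrier \<Gamma>. u = \<chi> x \<and> v = \<chi> y \<and> i = 0
          \<and> (\<exists>s\<in>S. \<chi> y = \<chi> s * \<chi> x))"
        by (simp only: arc_index_iff[OF nonzero])
      also have "\<dots> \<longleftrightarrow> (\<exists>x\<in>carrier \<Gamma>. \<exists>y\<in>carrier \<Gamma>. u = \<chi> x \<and> v = \<chi> y \<and> i = 0
          \<and> (\<exists>s\<in>S. y = s \<otimes> x))"
        using eq by (intro bex_cong refl conj_cong)
      also have "\<dots> \<longleftrightarrow> e \<in> ?R"
        unfolding e by (force simp: cayley_digraph_def)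
      finally show "e \<in> ?L \<longleftrightarrow> e \<in> ?R" .
    qed
    then show ?thesis
      unfolding weak_component_def component_of_1[OF gen] induce_subgraph_def app_iso_def
      by (simp add: poly_digraph_def cayley_digraph_def)
  qed
  ultimately show ?thesis unfolding digraph_iso_def by blast
qed

lemma polynomial_digraph_cayley:
  assumes gen: "generate \<Gamma> S = carrier \<Gamma>"
  shows "polynomial_digraph (cayley_digraph \<Gamma> S)"
proof -
  have "verts (weak_component (poly_digraph cayley_poly) 1) = \<chi> ` carrier \<Gamma>"
    by (simp add: weak_component_def component_of_1[OF gen])
  then have "\<forall>v\<in>verts (weak_component (poly_digraph cayley_poly) 1). \<not> singular_vertex cayley_poly v"
    using singular_vertex_imp_0 nonzero by force
  then show ?thesis
    unfolding polynomial_digraph_def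
    using regular_cayley_digraph[OF is_group fin S(1)] standard_cayley_poly
      cayley_digraph_iso_component[OF gen] by blast
qed

end

theorem corollary7:
  fixes \<Gamma> :: "'g monoid" and S :: "'g set"
  assumes "group \<Gamma>" and "finite (carrier \<Gamma>)" and "cyclic_group \<Gamma>"
    and "S \<subseteq> carrier \<Gamma>" and "S \<noteq> {}" and "\<one>\<^bsub>\<Gamma>\<^esub> \<notin> S"
    and "generate \<Gamma> S = carrier \<Gamma>"
  shows "polynomial_digraph (cayley_digraph \<Gamma> S)"
proof -
  obtain \<chi> :: "'g \<Rightarrow> complex" where "inj_on \<chi> (carrier \<Gamma>)" "\<And>x. \<chi> x \<noteq> 0"
    "\<And>x y. x \<in> carrier \<Gamma> \<Longrightarrow> y \<in> carrier \<Gamma> \<Longrightarrow> \<chi> (x \<otimes>\<^bsub>\<Gamma>\<^esub> y) = \<chi> x * \<chi> y"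
    using finite_cyclic_group_faithful_character assms(1-3) by blast
  then interpret faithful_character \<Gamma> \<chi> S
    using assms finite_subset[OF assms(4,2)]
    by (intro faithful_character.intro faithful_character_axioms.intro)
  show ?thesis using assms(7) by (rule polynomial_digraph_cayley)
qed

end
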